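(* There exist a linear congestion game $\mathcal{G}$ with three players and a matrix $\Gamma=(\gamma_{ij})\in\mathbb{R}^{3\times 3}$ with unitary main diagonal (i.e. $\gamma_{ii}=1$ for all $i$) and $0\le\gamma_{ij}\le 1$ for all $i,j$, such that the linear congestion game with restricted altruistic social context $(\mathcal{G},\Gamma)$ does not admit any pure Nash equilibrium.
   Context: Linear congestion game: a set of players $[n]=\{1,\dots,n\}$, $n\ge 2$, a finite set $E$ of resources, for each player $i$ a non-empty set $S_i\subseteq 2^E$ of strategies (each strategy is a non-empty subset of $E$), and for each $e\in E$ a latency function $\ell_e(x)=\alpha_e x+\beta_e$ with $\alpha_e,\beta_e\ge 0$. A strategy profile is $S=(s_1,\dots,s_n)$ with $s_i\in S_i$. The congestion of $e$ in $S$ is $n_e(S)=|\{j\in[n]:e\in s_j\}|$, and the cost of player $i$ in the underlying game is $c_i(S)=\sum_{e\in s_i}(\alpha_e n_e(S)+\beta_e)$. For $t\in S_i$, $S_{-i}\diamond t$ denotes the profile obtained from $S$ by replacing $s_i$ with $t$. A linear congestion game with altruistic social context is a pair $(\mathcal{G},\Gamma)$ where $\mathcal{G}$ is a linear congestion game with $n$ players and $\Gamma=(\gamma_{ij})\in\mathbb{R}^{n\times n}$ has non-negative entries; players and strategies are those of $\mathcal{G}$, but the cost of player $i$ in $S$ is $\widehat{c}_i(S)=\sum_{j\in[n]}\gamma_{ij}\,c_j(S)$. The social context is restricted if $\gamma_{ii}\ge\gamma_{ij}$ for all $i,j$. A pure Nash equilibrium of $(\mathcal{G},\Gamma)$ is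 a profile $S$ with $\widehat{c}_i(S)\le\widehat{c}_i(S_{-i}\diamond t)$ for every player $i$ and every $t\in S_i$. The matrix $\Gamma$ is not required to be symmetric. *)

theory Defs
  imports "HOL-Analysis.Analysis"
begin

text \<open>
  The players are the elements of a finite type \<open>'n\<close> (so an \<open>n\<close>-player game has
  \<open>CARD('n) = n\<close>); matrices indexed by pairs of players are then of type \<open>real ^ 'n ^ 'n\<close>.
  The latency of resource \<open>e\<close> is the function mapping \<open>x\<close> to \<open>slope e * x + offset e\<close>.
\<close>

record ('n, 'e) congestion_game =
  resources :: "'e set"
  strategies :: "'n \<Rightarrow> 'e set set"
  slope :: "'e \<Rightarrow> real"
  offset :: "'e \<Rightarrow> real"

definition linear_congestion_game :: "('n::finite, 'e) congestion_game \<Rightarrow> bool" where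
  "linear_congestion_game G \<longleftrightarrow>
     CARD('n) \<ge> 2 \<and>
     finite (resources G) \<and>
     (\<forall>i. strategies G i \<noteq> {} \<and> (\<forall>s\<in>strategies G i. s \<noteq> {} \<and> s \<subseteq> resources G)) \<and>
     (\<forall>e\<in>resources G. slope G e \<ge> 0 \<and> offset G e \<ge> 0)"

definition latency :: "('n, 'e) congestion_game \<Rightarrow> 'e \<Rightarrow> real \<Rightarrow> real" where
  "latency G e x = slope G e * x + offset G e"

definition profiles :: "('n, 'e) congestion_game \<Rightarrow> ('n \<Rightarrow> 'e set) set" where
  "profiles G = {S. \<forall>i. S i \<in> strategies G i}"

definition congestion :: "('n::finite \<Rightarrow> 'e set) \<Rightarrow> 'e \<Rightarrow> nat" where
  "congestion S e = card {j. e \<in> S j}"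

definition cost :: "('n::finite, 'e) congestion_game \<Rightarrow> ('n \<Rightarrow> 'e set) \<Rightarrow> 'n \<Rightarrow> real" where
  "cost G S i = (\<Sum>e\<in>S i. latency G e (real (congestion S e)))"

definition altruistic_social_context :: "real ^ 'n ^ 'n \<Rightarrow> bool" where
  "altruistic_social_context \<Gamma> \<longleftrightarrow> (\<forall>i j. \<Gamma> $ i $ j \<ge> 0)"

definition restricted_context :: "real ^ 'n ^ 'n \<Rightarrow> bool" where
  "restricted_context \<Gamma> \<longleftrightarrow> (\<forall>i j. \<Gamma> $ i $ i \<ge> \<Gamma> $ i $ j)"

definition altruistic_cost ::
  "('n::finite, 'e) congestion_game \<Rightarrow> real ^ 'n ^ 'n \<Rightarrow> ('n \<Rightarrow> 'e set) \<Rightarrow> 'n \<Rightarrow> real" where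
  "altruistic_cost G \<Gamma> S i = (\<Sum>j\<in>UNIV. \<Gamma> $ i $ j * cost G S j)"

definition pure_nash_equilibrium ::
  "('n::finite, 'e) congestion_game \<Rightarrow> real ^ 'n ^ 'n \<Rightarrow> ('n \<Rightarrow> 'e set) \<Rightarrow> bool" where
  "pure_nash_equilibrium G \<Gamma> S \<longleftrightarrow>
     S \<in> profiles G \<and>
     (\<forall>i. \<forall>t\<in>strategies G i. altruistic_cost G \<Gamma> S i \<le> altruistic_cost G \<Gamma> (S(i := t)) i)"

end

theory Submission
  imports Defs
begin

text \<open>
  As a function of \<open>s\<^sub>i\<close>, the cost of player \<open>i\<close> is, up to a constant,
  \<open>\<Sum>\<^sub>e \<alpha>\<^sub>e [e \<in> s\<^sub>i] (1 + \<Sum>\<^sub>j\<^sub>\<noteq>\<^sub>i (1 + \<gamma>\<^sub>i\<^sub>j) [e \<in> s\<^sub>j])\<close>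
  plus the offsets: a pairwise game in which player \<open>i\<close> weighs what is shared with player \<open>j\<close>
  by \<open>1 + \<gamma>\<^sub>i\<^sub>j \<in> [1, 2]\<close>. Let the weight be 2 for \<open>j = i - 1\<close> (cyclically) and 1 otherwise, so that
  each player is dominated by its predecessor. Two disjoint strategies per player, sharing one
  resource for each conflicting pair of choices, then make players 2 and 3 copy the choice of their
  predecessor and player 1 take the opposite choice of player 3, which is impossible.
\<close>

text \<open>Players 1 and 2 meet on \<open>0\<close> or \<open>1\<close>, and players 2 and 3 on
  \<open>2\<close> or \<open>3\<close>, when one plays its first listed set and the other its
  second; players 1 and 3 meet on \<open>4\<close> or \<open>5\<close> when they choose
  alike.\<close>

definition frustrated_game :: "(3, nat) congestion_game" where
  "frustrated_game =
     \<lparr>resources = {..<6},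
      strategies = (\<lambda>i. if i = 1 then {{0, 4}, {1, 5}}
                        else if i = 2 then {{1, 2}, {0, 3}}
                        else {{3, 4}, {2, 5}}),
      slope = (\<lambda>_. 1), offset = (\<lambda>_. 0)\<rparr>"

text \<open>In type \<open>3\<close> arithmetic is modulo 3, so \<open>1 - 1 = 3\<close>.\<close>

definition predecessor_context :: "real ^ 3 ^ 3" where
  "predecessor_context = (\<chi> i j. of_bool (j = i \<or> j = i - 1))"

lemma diff_one_3: "(1::3) - 1 = 3" "(2::3) - 1 = 1" "(3::3) - 1 = 2"
  by simp_all

lemma congestion_3:
  fixes S :: "3 \<Rightarrow> 'e set"
  shows "congestion S e = of_bool (e \<in> S 1) + of_bool (e \<in> S 2) + of_bool (e \<in> S 3)"
proof -
  have "congestion S e = (\<Sum>j\<in>UNIV. of_bool (e \<in> S j))"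
    by (simp add: congestion_def of_bool_def sum.If_cases)
  then show ?thesis
    by (simp only: sum_3)
qed

lemma altruistic_cost_predecessor_context:
  "altruistic_cost G predecessor_context S i = cost G S i + cost G S (i - 1)"
proof -
  \<comment> \<open>\<open>1 - 1\<close> can normalise to \<open>0\<close>, while
    \<open>sum_3\<close> calls the same player \<open>3\<close>.\<close>
  have "cost G S 3 = cost G S 0"
    by (rule arg_cong) simp
  then have "\<forall>i::3. altruistic_cost G predecessor_context S i = cost G S i + cost G S (i - 1)"
    by (simp add: forall_3 altruistic_cost_def predecessor_context_def sum_3 diff_one_3)
  then show ?thesis by blast
qed

lemma cost_frustrated_game:
  "cost frustrated_game S i = (\<Sum>e\<in>S i. real (congestion S e))"
  by (simp add: cost_def latency_def frustrated_game_def)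

lemma frustrated_game_no_equilibrium: "\<not> pure_nash_equilibrium frustrated_game predecessor_context S"
proof
  assume nash: "pure_nash_equilibrium frustrated_game predecessor_context S"
  have S: "S i \<in> strategies frustrated_game i" for i
    using nash by (simp add: pure_nash_equilibrium_def profiles_def)
  have S1: "S 1 = {0, 4} \<or> S 1 = {1, 5}"
    and S2: "S 2 = {1, 2} \<or> S 2 = {0, 3}"
    and S3: "S 3 = {3, 4} \<or> S 3 = {2, 5}"
    using S[of 1] S[of 2] S[of 3] by (simp_all add: frustrated_game_def)
  have stable: "cost frustrated_game S i + cost frustrated_game S (i - 1)
      \<le> cost frustrated_game (S(i := t)) i + cost frustrated_game (S(i := t)) (i - 1)"
    if "t \<in> strategies frustrated_game i" for i t
    using nash that by (simp add: pure_nash_equilibrium_def altruistic_cost_predecessor_context)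
  have strategy:
      "{0, 4} \<in> strategies frustrated_game 1" "{1, 5} \<in> strategies frustrated_game 1"
      "{1, 2} \<in> strategies frustrated_game 2" "{0, 3} \<in> strategies frustrated_game 2"
      "{3, 4} \<in> strategies frustrated_game 3" "{2, 5} \<in> strategies frustrated_game 3"
    by (simp_all add: frustrated_game_def)
  note costs = diff_one_3 cost_frustrated_game congestion_3
  \<comment> \<open>In each of the eight profiles one inequality is trivial; the other is the real
    deviation, where avoiding the predecessor (weight 2) beats avoiding the third player (weight
    1).\<close>
  have "S 1 = {0, 4} \<longleftrightarrow> S 3 = {2, 5}"
    using S1 S2 S3 strategy(1,2)[THEN stable, unfolded costs]
    by (elim disjE) (simp_all add: doubleton_eq_iff)
  moreover have "S 2 = {1, 2} \<longleftrightarrow> S 1 = {0, 4}"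
    using S1 S2 S3 strategy(3,4)[THEN stable, unfolded costs]
    by (elim disjE) (simp_all add: doubleton_eq_iff)
  moreover have "S 3 = {3, 4} \<longleftrightarrow> S 2 = {1, 2}"
    using S1 S2 S3 strategy(5,6)[THEN stable, unfolded costs]
    by (elim disjE) (simp_all add: doubleton_eq_iff)
  ultimately show False
    using S3 by auto
qed

theorem theorem3:
  shows "\<exists>(G :: (3, nat) congestion_game) (\<Gamma> :: real ^ 3 ^ 3).
    linear_congestion_game G \<and>
    altruistic_social_context \<Gamma> \<and> restricted_context \<Gamma> \<and>
    (\<forall>i. \<Gamma> $ i $ i = 1) \<and>
    (\<forall>i j. 0 \<le> \<Gamma> $ i $ j \<and> \<Gamma> $ i $ j \<le> 1) \<and>
    \<not> (\<exists>S. pure_nash_equilibrium G \<Gamma> S)"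
proof (intro exI conjI)
  show "linear_congestion_game frustrated_game"
    by (simp add: linear_congestion_game_def frustrated_game_def)
  show "\<not> (\<exists>S. pure_nash_equilibrium frustrated_game predecessor_context S)"
    using frustrated_game_no_equilibrium by blast
qed (simp_all add: altruistic_social_context_def restricted_context_def predecessor_context_def)

end
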